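(* For $\lambda\in(0,\frac12]$ and $\gamma\in(0,1)$, the optimal $(\lambda,\gamma)$-admissible polynomial of degree $1$ and the optimal gap of $(\lambda,\gamma)$-admissible degree-$1$ polynomials are $$p_1^{\lambda,\gamma}(x)=\frac{x-\lambda}{1-\lambda}\qquad\text{and}\qquad \alpha_1(\lambda,\gamma)=\frac{\lambda\gamma}{1-\lambda}.$$
   Context: For $\lambda\in(0,1)$ and $\gamma\in(0,1)$ with $\lambda(1+\gamma)<1$, a real polynomial $p$ is said to be $(\lambda,\gamma)$-admissible if: (i) $p(\lambda)=0$; (ii) for all $x\in[0,(1-\gamma)\lambda]$, $-1\le p(x)\le p((1-\gamma)\lambda)<0$; and (iii) for all $x\in[(1+\gamma)\lambda,1]$, $0<p((1+\gamma)\lambda)\le p(x)\le 1$. The $(\lambda,\gamma)$-admissible gap of a $(\lambda,\gamma)$-admissible polynomial $p$ is $\alpha(p;\lambda,\gamma)=\min\{-p((1-\gamma)\lambda),\,p((1+\gamma)\lambda)\}$. The optimal $(\lambda,\gamma)$-admissible polynomial of degree $n$, denoted $p_n^{\lambda,\gamma}$, is the maximizer of $\alpha(p;\lambda,\gamma)$ over all $(\lambda,\gamma)$-admissible polynomials $p$ of degree $n$, and $\alpha_n(\lambda,\gamma)=\alpha(p_n^{\lambda,\gamma};\lambda,\gamma)$ is the corresponding maximal value (the optimal gap). *)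

theory Defs
  imports Complex_Main "HOL-Computational_Algebra.Polynomial"
begin

definition admissible :: "real \<Rightarrow> real \<Rightarrow> real poly \<Rightarrow> bool" where
  "admissible l \<gamma> p \<longleftrightarrow>
     poly p l = 0 \<and>
     (\<forall>x\<in>{0..(1 - \<gamma>) * l}.
        -1 \<le> poly p x \<and> poly p x \<le> poly p ((1 - \<gamma>) * l) \<and> poly p ((1 - \<gamma>) * l) < 0) \<and>
     (\<forall>x\<in>{(1 + \<gamma>) * l..1}.
        0 < poly p ((1 + \<gamma>) * l) \<and> poly p ((1 + \<gamma>) * l) \<le> poly p x \<and> poly p x \<le> 1)"

definition gap :: "real \<Rightarrow> real \<Rightarrow> real poly \<Rightarrow> real" where
  "gap l \<gamma> p = min (- poly p ((1 - \<gamma>) * l)) (poly p ((1 + \<gamma>) * l))"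

definition is_optimal_poly :: "nat \<Rightarrow> real \<Rightarrow> real \<Rightarrow> real poly \<Rightarrow> bool" where
  "is_optimal_poly n l \<gamma> = is_arg_max (gap l \<gamma>) (\<lambda>p. admissible l \<gamma> p \<and> degree p = n)"

(* Unspecified unless the maximizer exists and is unique. *)
definition optimal_poly :: "nat \<Rightarrow> real \<Rightarrow> real \<Rightarrow> real poly" where
  "optimal_poly n l \<gamma> = (THE p. is_optimal_poly n l \<gamma> p)"

definition optimal_gap :: "nat \<Rightarrow> real \<Rightarrow> real \<Rightarrow> real" where
  "optimal_gap n l \<gamma> = gap l \<gamma> (optimal_poly n l \<gamma>)"

end

theory Submission
  imports Defs
begin

text \<open>A degree-one polynomial vanishing at \<open>l\<close> is \<open>c (x - l)\<close>, and its gap is \<open>c l \<gamma>\<close>.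
  The bound \<open>p 1 \<le> 1\<close> forces \<open>c \<le> 1 / (1 - l)\<close>; this extremal slope is itself
  admissible because \<open>l \<le> 1 / 2\<close> gives \<open>p 0 = - l / (1 - l) \<ge> - 1\<close>.\<close>

lemma degree_1_root_eq_smult:
  fixes p :: "'a::comm_ring_1 poly"
  assumes "degree p = 1" and "poly p l = 0"
  shows "p = smult (coeff p 1) [:- l, 1:]"
proof -
  obtain a b where p: "p = [:a, b:]"
    using degree1_coeffs[OF assms(1)] by blast
  have "a = - (l * b)"
    using assms(2) p by (simp add: eq_neg_iff_add_eq_0)
  with p show ?thesis by (simp add: mult.commute)
qed

lemma gap_linear: "gap l \<gamma> (smult c [:- l, 1:]) = c * (l * \<gamma>)"
  by (simp add: gap_def algebra_simps)

lemma slope_le_if_admissible: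
  assumes "admissible l \<gamma> (smult c [:- l, 1:])" and "(1 + \<gamma>) * l \<le> 1" and "l < 1"
  shows "c \<le> 1 / (1 - l)"
proof -
  \<comment> \<open>The bound on \<open>(1 + \<gamma>) * l\<close> places 1 in the right-hand
    interval of admissibility.\<close>
  have "poly (smult c [:- l, 1:]) 1 \<le> 1"
    using assms(1,2) unfolding admissible_def by (meson atLeastAtMost_iff order_refl)
  then show ?thesis
    using assms(3) by (simp add: field_simps)
qed

lemma admissible_extremal:
  assumes "0 < l" and "l \<le> 1 / 2" and "0 < \<gamma>"
  shows "admissible l \<gamma> (smult (1 / (1 - l)) [:- l, 1:])"
proof -
  have eval: "poly (smult (1 / (1 - l)) [:- l, 1:]) x = (x - l) / (1 - l)" for x
    by (simp add: diff_divide_distrib)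
  have "0 < l * \<gamma>" and pos: "0 < 1 - l"
    using assms by simp_all
  \<comment> \<open>As \<open>1 - l\<close> is positive, each condition on values becomes one on
    arguments, linear in \<open>x\<close>, \<open>l\<close> and the product
    \<open>l * \<gamma>\<close>.\<close>
  have mono: "(x - l) / (1 - l) \<le> (y - l) / (1 - l) \<longleftrightarrow> x \<le> y" for x y
    using pos by (simp add: divide_le_cancel)
  have bounds: "- 1 \<le> (x - l) / (1 - l) \<longleftrightarrow> 2 * l - 1 \<le> x" "(x - l) / (1 - l) \<le> 1 \<longleftrightarrow> x \<le> 1"
    "(x - l) / (1 - l) < 0 \<longleftrightarrow> x < l" "0 < (x - l) / (1 - l) \<longleftrightarrow> l < x" for x
    using pos by (auto simp: pos_le_divide_eq divide_less_0_iff zero_less_divide_iff)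
  show ?thesis
    using assms \<open>0 < l * \<gamma>\<close> unfolding admissible_def eval mono bounds
    by (auto simp: algebra_simps)
qed

text \<open>An equivalence, because \<open>optimal_poly\<close> is a definite description and so
  needs uniqueness as well as maximality.\<close>

lemma is_optimal_poly_1_iff:
  assumes "0 < l" and "l \<le> 1 / 2" and "0 < \<gamma>" and "\<gamma> < 1"
  shows "is_optimal_poly 1 l \<gamma> p \<longleftrightarrow> p = smult (1 / (1 - l)) [:- l, 1:]"
proof -
  define q where "q = smult (1 / (1 - l)) [:- l, 1:]"
  have le1: "(1 + \<gamma>) * l \<le> 1"
    using mult_mono[of "1 + \<gamma>" 2 l "1 / 2"] assms by simp
  have q: "admissible l \<gamma> q" "degree q = 1"
    using admissible_extremal assms by (auto simp: q_def)
  have pos: "0 < l * \<gamma>"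
    using assms by simp
  \<comment> \<open>The strict inequality gives uniqueness: since \<open>l * \<gamma>\<close> is
    positive, any smaller slope strictly lowers the gap.\<close>
  have max: "gap l \<gamma> r < gap l \<gamma> q \<or> r = q" if "admissible l \<gamma> r" "degree r = 1" for r
  proof -
    have r: "r = smult (coeff r 1) [:- l, 1:]"
      using that degree_1_root_eq_smult by (auto simp: admissible_def)
    then have "coeff r 1 \<le> 1 / (1 - l)"
      using that(1) le1 assms(2) by (intro slope_le_if_admissible[of l \<gamma>]) auto
    then have "coeff r 1 < 1 / (1 - l) \<or> r = q"
      using r unfolding q_def by (metis order_le_less)
    moreover have "gap l \<gamma> r = coeff r 1 * (l * \<gamma>)"
      by (subst r) (rule gap_linear)
    moreover have "gap l \<gamma> q = 1 / (1 - l) * (l * \<gamma>)"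
      unfolding q_def by (rule gap_linear)
    ultimately show ?thesis
      using pos by (metis mult_strict_right_mono)
  qed
  \<comment> \<open>By \<open>max\<close>, no candidate beats \<open>q\<close>, and \<open>q\<close>
    beats every other candidate.\<close>
  show ?thesis
    unfolding is_optimal_poly_def is_arg_max_def q_def[symmetric]
    using max q by (metis order_less_asym)
qed

theorem proposition2:
  fixes l \<gamma> :: real
  assumes "0 < l" and "l \<le> 1 / 2" and "0 < \<gamma>" and "\<gamma> < 1"
  shows "(\<exists>!p. is_optimal_poly 1 l \<gamma> p) \<and>
         optimal_poly 1 l \<gamma> = smult (1 / (1 - l)) [:- l, 1:] \<and>
         optimal_gap 1 l \<gamma> = l * \<gamma> / (1 - l)"
proof -
  note iff = is_optimal_poly_1_iff[OF assms]
  have opt: "optimal_poly 1 l \<gamma> = smult (1 / (1 - l)) [:- l, 1:]"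
    unfolding optimal_poly_def iff by (rule the_eq_trivial)
  then have "optimal_gap 1 l \<gamma> = l * \<gamma> / (1 - l)"
    unfolding optimal_gap_def opt gap_linear by simp
  with opt show ?thesis
    unfolding iff by blast
qed

end
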